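(* Let $0<\alpha\le 1$ and $a<b$. Let $r$ be a continuous, nonnegative function on the interval $J=[a,b]$ and let $\delta$ and $k$ be nonnegative constants such that $$r(t)\le \delta+\int_a^t k\,r(s)(s-a)^{\alpha-1}\,ds\qquad (t\in J).$$ Then for all $t\in J$ $$r(t)\le \delta\, e^{k\frac{(t-a)^\alpha}{\alpha}}.$$ *)

theory Defs
  imports "HOL-Analysis.Analysis"
begin

end

theory Submission
  imports Defs
begin

text \<open>The weight \<open>(s - a) powr (\<alpha> - 1)\<close> may blow up at \<open>a\<close>, but it is integrable with
  primitive \<open>(t - a) powr \<alpha> / \<alpha>\<close>, continuous on all of \<open>{a..b}\<close>. Let \<open>F t\<close> be the right-hand
  side of the hypothesis; then \<open>r \<le> F\<close> makes \<open>F t * exp (- k * ((t - a) powr \<alpha> / \<alpha>))\<close>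
  nonincreasing, and its value at \<open>a\<close> is \<open>\<delta>\<close>.\<close>

lemma has_real_derivative_shifted_powr:
  fixes \<alpha> a t :: real
  assumes "0 < \<alpha>" and "a < t"
  shows "((\<lambda>s. (s - a) powr \<alpha> / \<alpha>) has_real_derivative (t - a) powr (\<alpha> - 1)) (at t)"
  using assms by (auto intro!: derivative_eq_intros simp: powr_diff field_simps)

text \<open>On \<open>{a..b}\<close> the base stays nonnegative and vanishes only at
  \<open>a\<close>, where the positive exponent secures continuity.\<close>

lemma continuous_on_shifted_powr:
  fixes \<alpha> a b :: real
  assumes "0 < \<alpha>"
  shows "continuous_on {a..b} (\<lambda>s. (s - a) powr \<alpha> / \<alpha>)"
  using assms by (auto intro!: continuous_intros continuous_on_powr')

text \<open>The fundamental theorem asks for the derivative of the primitive only in the open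
  interval, so the singularity at \<open>a\<close> is harmless. Nonnegativity then makes the
  integrability absolute, which survives multiplication by a bounded measurable factor.\<close>

lemma absolutely_integrable_shifted_powr:
  fixes \<alpha> a b :: real
  assumes "0 < \<alpha>" and "a \<le> b"
  shows "(\<lambda>s. (s - a) powr (\<alpha> - 1)) absolutely_integrable_on {a..b}"
proof (rule nonnegative_absolutely_integrable_1)
  have "((\<lambda>s. (s - a) powr (\<alpha> - 1)) has_integral
      (b - a) powr \<alpha> / \<alpha> - (a - a) powr \<alpha> / \<alpha>) {a..b}"
    using assms
    by (intro fundamental_theorem_of_calculus_interior continuous_on_shifted_powr)
       (auto intro: has_real_derivative_shifted_powr
             simp flip: has_real_derivative_iff_has_vector_derivative)
  then show "(\<lambda>s. (s - a) powr (\<alpha> - 1)) integrable_on {a..b}"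
    by blast
qed simp

text \<open>The product may be unbounded near \<open>a\<close>, so \<open>g\<close> enters only as a
  measurable factor that is bounded by compactness of \<open>{a..b}\<close>.\<close>

lemma integrable_continuous_mult_shifted_powr:
  fixes \<alpha> a b :: real and g :: "real \<Rightarrow> real"
  assumes "0 < \<alpha>" and "a \<le> b" and g: "continuous_on {a..b} g"
  shows "(\<lambda>s. g s * (s - a) powr (\<alpha> - 1)) integrable_on {a..b}"
proof -
  have "g \<in> borel_measurable (lebesgue_on {a..b})"
    using g by (intro continuous_imp_measurable_on_sets_lebesgue) auto
  moreover have "bounded (g ` {a..b})"
    using g by (intro compact_imp_bounded compact_continuous_image) auto
  ultimately have "(\<lambda>s. g s * (s - a) powr (\<alpha> - 1)) absolutely_integrable_on {a..b}"
    using absolutely_integrable_shifted_powr[OF assms(1,2)]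
    by (intro absolutely_integrable_bounded_measurable_product_real) auto
  then show ?thesis
    by (rule set_lebesgue_integral_eq_integral(1))
qed

theorem theorem2p13:
  fixes \<alpha> a b \<delta> k :: real and r :: "real \<Rightarrow> real"
  assumes "0 < \<alpha>" and "\<alpha> \<le> 1" and "a < b"
    and "continuous_on {a..b} r"
    and "\<And>t. t \<in> {a..b} \<Longrightarrow> 0 \<le> r t"
    and "0 \<le> \<delta>" and "0 \<le> k"
    and "\<And>t. t \<in> {a..b} \<Longrightarrow>
      r t \<le> \<delta> + integral {a..t} (\<lambda>s. k * r s * (s - a) powr (\<alpha> - 1))"
  shows "\<forall>t\<in>{a..b}. r t \<le> \<delta> * exp (k * ((t - a) powr \<alpha> / \<alpha>))"
proof
  fix t assume t: "t \<in> {a..b}"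
  define f where "f = (\<lambda>s. k * r s * (s - a) powr (\<alpha> - 1))"
  define P where "P = (\<lambda>s. (s - a) powr \<alpha> / \<alpha>)"
  define F where "F = (\<lambda>u. \<delta> + integral {a..u} f)"
  define G where "G = (\<lambda>u. F u * exp (- k * P u))"
  have f_int: "f integrable_on {a..b}"
    unfolding f_def using assms
    by (intro integrable_continuous_mult_shifted_powr continuous_intros) auto
  have rF: "r u \<le> F u" if "u \<in> {a..b}" for u
    using assms(8)[OF that] by (simp add: F_def f_def)
  have P': "(P has_real_derivative (u - a) powr (\<alpha> - 1)) (at u)" if "a < u" for u
    unfolding P_def using \<open>0 < \<alpha>\<close> that by (rule has_real_derivative_shifted_powr)
  \<comment> \<open>Since \<open>f\<close> can be discontinuous at \<open>a\<close>, differentiation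
    is confined to interior points, where the derivative within \<open>{a..b}\<close> is also the
    two-sided one.\<close>
  have F': "(F has_real_derivative f u) (at u)" if "a < u" "u < b" for u
  proof -
    have "isCont r u"
      using assms(4) that by (intro continuous_on_interior[of "{a..b}"]) auto
    then have "isCont f u"
      unfolding f_def using that by (auto intro!: continuous_intros)
    then have "((\<lambda>u. integral {a..u} f) has_vector_derivative f u) (at u within {a..b})"
      using that f_int integral_has_vector_derivative_continuous_at[of f a b u "{}"]
      by (simp add: continuous_at_imp_continuous_at_within)
    then have "((\<lambda>u. integral {a..u} f) has_real_derivative f u) (at u)"
      using that at_within_interior[of u "{a..b}"]
      by (simp add: has_real_derivative_iff_has_vector_derivative)
    then show ?thesis
      unfolding F_def by (auto intro!: derivative_eq_intros)
  qed
  have "continuous_on {a..b} G"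
    unfolding G_def F_def P_def using f_int \<open>0 < \<alpha>\<close>
    by (intro continuous_intros continuous_on_shifted_powr indefinite_integral_continuous_1)
  then have "continuous_on {a..t} G"
    using t by (auto elim: continuous_on_subset)
  \<comment> \<open>With \<open>G\<close> continuous on \<open>{a..t}\<close>, the sign of its
    derivative in the open interval is enough for monotonicity.\<close>
  moreover have "\<exists>D. (G has_real_derivative D) (at u) \<and> D \<le> 0" if "a < u" "u < t" for u
  proof (intro exI conjI)
    \<comment> \<open>In the product rule both \<open>f u\<close> and the derivative of
      \<open>k * P\<close> carry the factor \<open>k * (u - a) powr (\<alpha> - 1)\<close>; pulling
      it out leaves \<open>r u - F u\<close>, which \<open>rF\<close> makes nonpositive.\<close>
    show "(G has_real_derivative k * (u - a) powr (\<alpha> - 1) * (r u - F u) * exp (- k * P u)) (at u)"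
      unfolding G_def using that t
      by (auto intro!: derivative_eq_intros F' P' simp: f_def) (simp add: algebra_simps)
    show "k * (u - a) powr (\<alpha> - 1) * (r u - F u) * exp (- k * P u) \<le> 0"
      using rF[of u] that t \<open>0 \<le> k\<close> by (intro mult_nonpos_nonneg mult_nonneg_nonpos) auto
  qed
  ultimately have "G t \<le> G a"
    using t by (intro DERIV_nonpos_imp_decreasing_open[of a t G]) simp_all
  \<comment> \<open>The integral over \<open>{a..a}\<close> vanishes, and \<open>P a = 0\<close>
    makes the exponential 1.\<close>
  also have "G a = \<delta>"
    using \<open>0 < \<alpha>\<close> by (simp add: G_def F_def P_def)
  finally have "F t \<le> \<delta> * exp (k * P t)"
    by (simp add: G_def exp_minus field_simps)
  with rF[OF t] show "r t \<le> \<delta> * exp (k * ((t - a) powr \<alpha> / \<alpha>))"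
    by (simp add: P_def)
qed

end
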